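(* For any two finite abstract simplicial complexes $G,H$, the functional $i(G)=1-\chi(G)$ satisfies $$i(G+H)=i(G)\, i(H),$$ where $G+H$ is the join.
   Context: A finite abstract simplicial complex is a finite set of non-empty finite sets (simplices) closed under taking non-empty subsets; a simplex $x$ has dimension $|x|-1$. For complexes $G,H$ on disjoint vertex sets, the join $G+H$ has as simplices the simplices of $G$, the simplices of $H$, and all unions $x\cup y$ with $x\in G$, $y\in H$. The Euler characteristic is $\chi(G)=\sum_{x\in G}(-1)^{\dim(x)}$. *)

theory Defs
  imports Main
begin

definition finite_abstract_simplicial_complex :: "'a set set \<Rightarrow> bool" where
  "finite_abstract_simplicial_complex G \<longleftrightarrow>
     finite G \<and>
     (\<forall>x\<in>G. finite x \<and> x \<noteq> {}) \<and>
     (\<forall>x\<in>G. \<forall>y. y \<subseteq> x \<and> y \<noteq> {} \<longrightarrow> y \<in> G)"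

definition vertices :: "'a set set \<Rightarrow> 'a set" where
  "vertices G = \<Union>G"

(* The truncated subtraction is harmless: simplices are finite and non-empty. *)
definition simplex_dim :: "'a set \<Rightarrow> nat" where
  "simplex_dim x = card x - 1"

definition euler_char :: "'a set set \<Rightarrow> int" where
  "euler_char G = (\<Sum>x\<in>G. (-1) ^ simplex_dim x)"

(* G and H are listed separately because the empty set is not a simplex. This is the join
   only for complexes with disjoint vertex sets. *)
definition join :: "'a set set \<Rightarrow> 'a set set \<Rightarrow> 'a set set" where
  "join G H = G \<union> H \<union> {x \<union> y | x y. x \<in> G \<and> y \<in> H}"

definition i_functional :: "'a set set \<Rightarrow> int" where
  "i_functional G = 1 - euler_char G"

lemma finite_abstract_simplicial_complex_join:
  assumes "finite_abstract_simplicial_complex G" "finite_abstract_simplicial_complex H"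
  shows "finite_abstract_simplicial_complex (join G H)"
  unfolding finite_abstract_simplicial_complex_def
proof (intro conjI ballI allI impI)
  have fin: "finite K" "\<And>x. x \<in> K \<Longrightarrow> finite x" "\<And>x. x \<in> K \<Longrightarrow> x \<noteq> {}"
    and sub: "\<And>x y. x \<in> K \<Longrightarrow> y \<subseteq> x \<Longrightarrow> y \<noteq> {} \<Longrightarrow> y \<in> K"
    if "finite_abstract_simplicial_complex K" for K :: "'a set set"
    using that unfolding finite_abstract_simplicial_complex_def by blast+
  note G = fin[OF assms(1)] and H = fin[OF assms(2)]
  have "finite {x \<union> y | x y. x \<in> G \<and> y \<in> H}"
    using G(1) H(1) by (rule finite_image_set2[of "\<lambda>x. x \<in> G" "\<lambda>y. y \<in> H", simplified])
  then show "finite (join G H)"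
    unfolding join_def using G(1) H(1) by (intro finite_UnI)
  fix z assume z: "z \<in> join G H"
  then consider "z \<in> G" | "z \<in> H" | x y where "x \<in> G" "y \<in> H" "z = x \<union> y"
    unfolding join_def by blast
  note cases_z = this
  show "finite z"
    by (rule cases_z) (blast intro: G(2) H(2))+
  show "z \<noteq> {}"
    by (rule cases_z) (use G(3) H(3) in blast)+
  fix w assume w: "w \<subseteq> z \<and> w \<noteq> {}"
  show "w \<in> join G H"
  proof (rule cases_z)
    assume "z \<in> G"
    then have "w \<in> G" using sub[OF assms(1)] w by blast
    then show ?thesis unfolding join_def by blast
  next
    assume "z \<in> H"
    then have "w \<in> H" using sub[OF assms(2)] w by blast
    then show ?thesis unfolding join_def by blast
  next
    fix x y assume xy: "x \<in> G" "y \<in> H" "z = x \<union> y"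
    have eq: "w = (w \<inter> x) \<union> (w \<inter> y)" using w xy(3) by blast
    have x: "w \<inter> x \<noteq> {} \<Longrightarrow> w \<inter> x \<in> G" by (rule sub[OF assms(1) xy(1) Int_lower2])
    have y: "w \<inter> y \<noteq> {} \<Longrightarrow> w \<inter> y \<in> H" by (rule sub[OF assms(2) xy(2) Int_lower2])
    consider "w \<inter> y = w" | "w \<inter> x = w" | "w \<inter> x \<noteq> {}" "w \<inter> y \<noteq> {}"
      using eq by blast
    then show ?thesis
    proof cases
      case 1
      then have "w \<in> H" using y w by metis
      then show ?thesis unfolding join_def by blast
    next
      case 2
      then have "w \<in> G" using x w by metis
      then show ?thesis unfolding join_def by blast
    next
      case 3
      have "(w \<inter> x) \<union> (w \<inter> y) \<in> join G H"
        unfolding join_def using x[OF 3(1)] y[OF 3(2)] by blast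
      then show ?thesis using eq by metis
    qed
  qed
qed

end

theory Submission
  imports Defs
begin

text \<open>Adjoining the empty simplex turns \<open>1 - \<chi>\<close> into the sum of \<open>(-1) ^ card x\<close>, and it turns
  the join into the set of all unions \<open>x \<union> y\<close>. As the vertex sets are disjoint, the pair
  \<open>(x, y)\<close> is recovered from \<open>x \<union> y\<close> and cardinalities add up, so the sum factorizes.\<close>

lemma i_functional_eq_sum_card:
  assumes "finite_abstract_simplicial_complex G"
  shows "i_functional G = (\<Sum>x\<in>insert {} G. (-1) ^ card x)"
proof -
  have G: "finite G" "{} \<notin> G" "\<And>x. x \<in> G \<Longrightarrow> 0 < card x"
    using assms unfolding finite_abstract_simplicial_complex_def by (auto simp: card_gt_0_iff)
  \<comment> \<open>Since \<open>x\<close> is non-empty, \<open>card x\<close> is exactly one more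
    than its dimension, so the sign flips. The 1 in \<open>1 - euler_char G\<close> becomes the term
    of \<open>{}\<close>.\<close>
  have "(-1) ^ card x = - ((-1) ^ simplex_dim x :: int)" if "x \<in> G" for x
    using G(3)[OF that] unfolding simplex_dim_def by (cases "card x") auto
  then show ?thesis
    using G(1,2) by (simp add: i_functional_def euler_char_def sum_negf)
qed

text \<open>Choosing \<open>{}\<close> in both factors, in one, or in neither yields
  \<open>{}\<close>, the members of \<open>G\<close> and of \<open>H\<close>, and the mixed
  unions.\<close>

lemma insert_empty_join:
  "insert {} (join G H) = (\<lambda>(x, y). x \<union> y) ` (insert {} G \<times> insert {} H)"
  unfolding join_def by (auto simp: image_iff)

lemma inj_on_Un_disjoint_vertices:
  assumes "vertices G \<inter> vertices H = {}"
  shows "inj_on (\<lambda>(x, y). x \<union> y) (insert {} G \<times> insert {} H)"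
\<comment> \<open>Cutting \<open>x \<union> y\<close> with \<open>vertices G\<close> keeps
  \<open>x\<close> and removes \<open>y\<close>, and symmetrically for \<open>H\<close>.\<close>
proof (rule inj_on_inverseI[where g = "\<lambda>z. (z \<inter> vertices G, z \<inter> vertices H)"])
  fix p assume "p \<in> insert {} G \<times> insert {} H"
  then have "fst p \<subseteq> vertices G" "snd p \<subseteq> vertices H"
    unfolding vertices_def by auto
  then show "(\<lambda>z. (z \<inter> vertices G, z \<inter> vertices H)) ((\<lambda>(x, y). x \<union> y) p) = p"
    using assms by (cases p) auto
qed

theorem corollary4:
  fixes G H :: "'a set set"
  assumes "finite_abstract_simplicial_complex G"
    and "finite_abstract_simplicial_complex H"
    and "vertices G \<inter> vertices H = {}"
  shows "i_functional (join G H) = i_functional G * i_functional H"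
proof -
  have card_Un: "card (x \<union> y) = card x + card y"
    if "x \<in> insert {} G" "y \<in> insert {} H" for x y
  proof (rule card_Un_disjoint)
    show "finite x" "finite y"
      using that assms(1,2) unfolding finite_abstract_simplicial_complex_def by auto
    show "x \<inter> y = {}"
      using that assms(3) unfolding vertices_def by blast
  qed
  have "i_functional (join G H) = (\<Sum>z\<in>insert {} (join G H). (-1) ^ card z)"
    using assms(1,2)
    by (intro i_functional_eq_sum_card finite_abstract_simplicial_complex_join)
  also have "\<dots> = (\<Sum>(x, y)\<in>insert {} G \<times> insert {} H. (-1) ^ card (x \<union> y))"
    \<comment> \<open>By injectivity each simplex of the join is counted for exactly one
      pair.\<close>
    unfolding insert_empty_join sum.reindex[OF inj_on_Un_disjoint_vertices[OF assms(3)]]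
    by (simp add: comp_def case_prod_beta)
  also have "\<dots> = (\<Sum>(x, y)\<in>insert {} G \<times> insert {} H. (-1) ^ card x * (-1) ^ card y)"
    by (intro sum.cong refl) (clarify, simp only: card_Un power_add)
  also have "\<dots> = i_functional G * i_functional H"
    unfolding i_functional_eq_sum_card[OF assms(1)] i_functional_eq_sum_card[OF assms(2)]
    by (simp only: sum_product sum.cartesian_product)
  finally show ?thesis .
qed

end
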